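(* Let $K$ be an algebraically closed field and let $\mathfrak{a}\subsetneq K[X_1,\ldots,X_n]$ be a non-unit ideal. Then $\mathrm{V}_K(\mathfrak{a})\neq\emptyset$.
   Context: For an ideal $\mathfrak{a}\subseteq K[X_1,\ldots,X_n]$, $\mathrm{V}_K(\mathfrak{a}):=\{a\in K^n\mid f(a)=0\text{ for all }f\in\mathfrak{a}\}$. A non-unit ideal is an ideal different from the whole ring. *)

theory Defs
  imports
    "HOL-Library.Poly_Mapping"
    "HOL-Library.FuncSet"
    "HOL-Algebra.Ideal"
    "HOL-Computational_Algebra.Polynomial"
begin

text \<open>
  A polynomial is a finitely supported map from exponent vectors to coefficients; addition and
  the convolution product are those of \<^theory>\<open>HOL-Library.Poly_Mapping\<close>.
  The \<open>n\<close> variables are indexed by \<open>{..<n}\<close>, and \<open>n = 0\<close> is allowed.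
\<close>

type_synonym 'a mpoly = "(nat \<Rightarrow>\<^sub>0 nat) \<Rightarrow>\<^sub>0 'a"

definition mpoly_vars :: "'a::zero mpoly \<Rightarrow> nat set" where
  "mpoly_vars p = (\<Union>m\<in>Poly_Mapping.keys p. Poly_Mapping.keys m)"

definition mpoly_ring :: "nat \<Rightarrow> 'a::comm_ring_1 mpoly ring" where
  "mpoly_ring n =
     \<lparr>carrier = {p. mpoly_vars p \<subseteq> {..<n}}, monoid.mult = (*), one = 1, ring.zero = 0, add = (+)\<rparr>"

definition mpoly_eval :: "'a::comm_semiring_1 mpoly \<Rightarrow> (nat \<Rightarrow> 'a) \<Rightarrow> 'a" where
  "mpoly_eval p a =
     (\<Sum>m\<in>Poly_Mapping.keys p. Poly_Mapping.lookup p m *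
        (\<Prod>i\<in>Poly_Mapping.keys m. a i ^ Poly_Mapping.lookup m i))"

definition affine_space :: "nat \<Rightarrow> (nat \<Rightarrow> 'a) set" where
  "affine_space n = {..<n} \<rightarrow>\<^sub>E UNIV"

definition zero_locus :: "nat \<Rightarrow> 'a::comm_semiring_1 mpoly set \<Rightarrow> (nat \<Rightarrow> 'a) set" where
  "zero_locus n I = {a \<in> affine_space n. \<forall>f\<in>I. mpoly_eval f a = 0}"

lemma mpoly_vars_add: "mpoly_vars (p + q) \<subseteq> mpoly_vars p \<union> mpoly_vars q"
  unfolding mpoly_vars_def using Poly_Mapping.keys_add[of p q] by blast

lemma mpoly_vars_uminus: "mpoly_vars (- p) = mpoly_vars (p :: 'a::ab_group_add mpoly)"
  by (simp add: mpoly_vars_def Poly_Mapping.keys_def uminus_poly_mapping.rep_eq)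

lemma mpoly_vars_mult: "mpoly_vars (p * q) \<subseteq> mpoly_vars p \<union> mpoly_vars q"
proof
  fix i assume "i \<in> mpoly_vars (p * q)"
  then obtain m where m: "m \<in> Poly_Mapping.keys (p * q)" "i \<in> Poly_Mapping.keys m"
    by (auto simp: mpoly_vars_def)
  then obtain a b where "m = a + b" "a \<in> Poly_Mapping.keys p" "b \<in> Poly_Mapping.keys q"
    using Poly_Mapping.keys_mult[of p q] by blast
  with m(2) show "i \<in> mpoly_vars p \<union> mpoly_vars q"
    using Poly_Mapping.keys_add[of a b] unfolding mpoly_vars_def by blast
qed

text \<open>The locale \<^locale>\<open>ideal\<close> presupposes a ring, so this is what makes ideals of
  \<^const>\<open>mpoly_ring\<close> meaningful.\<close>

lemma cring_mpoly_ring: "cring (mpoly_ring n :: 'a::comm_ring_1 mpoly ring)"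
proof (rule cringI)
  show "abelian_group (mpoly_ring n :: 'a mpoly ring)"
  proof (rule abelian_groupI, goal_cases)
    case (1 x y) then show ?case using mpoly_vars_add[of x y] by (auto simp: mpoly_ring_def)
  next
    case (6 x)
    then have "- x \<in> carrier (mpoly_ring n)" by (simp add: mpoly_ring_def mpoly_vars_uminus)
    then show ?case by (intro bexI[of _ "- x"]) (simp_all add: mpoly_ring_def)
  qed (auto simp: mpoly_ring_def mpoly_vars_def add_ac)
  show "comm_monoid (mpoly_ring n :: 'a mpoly ring)"
  proof (rule comm_monoidI, goal_cases)
    case (1 x y) then show ?case using mpoly_vars_mult[of x y] by (auto simp: mpoly_ring_def)
  qed (auto simp: mpoly_ring_def mpoly_vars_def mult_ac)
qed (auto simp: mpoly_ring_def algebra_simps)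

end

theory Submission
  imports Defs "HOL-Algebra.Ring_Divisibility"
begin

text \<open>Enlarge the ideal to a prime ideal \<open>P\<close>. By induction on \<open>k\<close>, for every
  \<open>f\<close> outside \<open>P\<close> in the first \<open>k\<close> variables, some point kills all elements of \<open>P\<close> in these
  variables but not \<open>f\<close>; taking \<open>f = 1\<close> and \<open>k = n\<close> gives the zero. In the induction step,
  the extension by one variable is either transcendental or algebraic modulo \<open>P\<close>, and in both
  cases some \<open>e\<close> outside \<open>P\<close> in fewer variables has the property that every point with \<open>e \<noteq> 0\<close>
  extends to the new variable.\<close>

hide_const (open) up_ring.coeff up_ring.monom module.smult

section \<open>Ring morphisms and polynomials in one variable\<close>

definition ring_morphism :: "('r::comm_ring_1 \<Rightarrow> 's::comm_ring_1) \<Rightarrow> bool" where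
  "ring_morphism \<psi> \<longleftrightarrow> \<psi> 1 = 1 \<and> (\<forall>x y. \<psi> (x + y) = \<psi> x + \<psi> y) \<and> (\<forall>x y. \<psi> (x * y) = \<psi> x * \<psi> y)"

lemma ring_morphism_one: "ring_morphism \<psi> \<Longrightarrow> \<psi> 1 = 1"
  and ring_morphism_add: "ring_morphism \<psi> \<Longrightarrow> \<psi> (x + y) = \<psi> x + \<psi> y"
  and ring_morphism_mult: "ring_morphism \<psi> \<Longrightarrow> \<psi> (x * y) = \<psi> x * \<psi> y"
  by (auto simp: ring_morphism_def)

lemma ring_morphism_zero: "ring_morphism \<psi> \<Longrightarrow> \<psi> 0 = 0"
  using ring_morphism_add[of \<psi> 0 0] by simp

lemma ring_morphism_minus: "ring_morphism \<psi> \<Longrightarrow> \<psi> (x - y) = \<psi> x - \<psi> y"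
  using ring_morphism_add[of \<psi> "x - y" y] by simp

lemma ring_morphism_power: "ring_morphism \<psi> \<Longrightarrow> \<psi> (x ^ k) = \<psi> x ^ k"
  by (induction k) (simp_all add: ring_morphism_one ring_morphism_mult)

text \<open>The coefficients are mapped by a separate \<open>\<phi>\<close>: in the application
  \<open>\<phi>\<close> is \<open>\<psi> 0\<close> and \<open>\<psi>\<close> is
  \<open>\<psi> t\<close>, which agree only on the base ring.\<close>

lemma ring_morphism_poly:
  assumes "ring_morphism \<psi>" "\<phi> 0 = 0" "\<And>i. \<psi> (coeff p i) = \<phi> (coeff p i)"
  shows "\<psi> (poly p x) = poly (map_poly \<phi> p) (\<psi> x)"
  using assms(3)
proof (induction p)
  case 0
  then show ?case by (simp add: ring_morphism_zero[OF assms(1)])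
next
  case (pCons a p)
  have "\<psi> (coeff p i) = \<phi> (coeff p i)" for i
    using pCons.prems[of "Suc i"] by simp
  moreover have "\<psi> a = \<phi> a"
    using pCons.prems[of 0] by simp
  ultimately show ?case
    using pCons assms(1,2)
    by (simp add: map_poly_pCons ring_morphism_add ring_morphism_mult)
qed

text \<open>For nonconstant \<open>q\<close>, a root of \<open>q - 1\<close> is a point where
  \<open>q\<close> takes the value 1.\<close>

lemma alg_closed_exists_nonroot:
  fixes q :: "'k::alg_closed_field poly"
  assumes "q \<noteq> 0"
  obtains t where "poly q t \<noteq> 0"
proof (cases "degree q = 0")
  case True
  then obtain c where "q = [:c:]"
    by (auto elim: degree_eq_zeroE)
  with assms show ?thesis by (intro that[of 0]) auto
next
  case False
  have "degree (q - 1) = degree q"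
    using False degree_add_eq_left[of "- 1" q] by simp
  then obtain t where "poly (q - 1) t = 0"
    using alg_closed_imp_poly_has_root[of "q - 1"] False by auto
  then show ?thesis by (intro that[of t]) auto
qed

lemma degree_drop_lead:
  fixes p :: "'a::comm_ring_1 poly"
  assumes "degree p > 0"
  shows "degree (p - monom (lead_coeff p) (degree p)) < degree p"
proof -
  let ?q = "p - monom (lead_coeff p) (degree p)"
  have "degree ?q \<le> degree p"
    by (intro degree_diff_le) (auto simp: degree_monom_le)
  moreover have "coeff ?q (degree p) = 0" by simp
  ultimately show ?thesis
    using assms by (metis le_neq_implies_less leading_coeff_0_iff degree_0)
qed

section \<open>A prime ideal in a simple ring extension\<close>

text \<open>\<open>A\<close> is a subring and A[X] consists of the values \<open>poly p X\<close>
  with coefficients of \<open>p\<close> in \<open>A\<close>. Absorption and primality are required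
  only for factors from A[X], so \<open>P\<close> may be prime merely in some ring between A[X] and
  the whole type.\<close>

locale prime_in_simple_extension =
  fixes A P :: "'r::comm_ring_1 set" and X :: 'r
  assumes one_A: "1 \<in> A"
    and add_A: "x \<in> A \<Longrightarrow> y \<in> A \<Longrightarrow> x + y \<in> A"
    and uminus_A: "x \<in> A \<Longrightarrow> - x \<in> A"
    and mult_A: "x \<in> A \<Longrightarrow> y \<in> A \<Longrightarrow> x * y \<in> A"
    and zero_P: "0 \<in> P"
    and one_P: "1 \<notin> P"
    and add_P: "x \<in> P \<Longrightarrow> y \<in> P \<Longrightarrow> x + y \<in> P"
    and mult_P: "(\<And>i. coeff p i \<in> A) \<Longrightarrow> x \<in> P \<Longrightarrow> poly p X * x \<in> P"
    and prime_P: "(\<And>i. coeff p i \<in> A) \<Longrightarrow> (\<And>i. coeff q i \<in> A) \<Longrightarrow>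
      poly p X * poly q X \<in> P \<Longrightarrow> poly p X \<in> P \<or> poly q X \<in> P"
begin

lemma zero_A: "0 \<in> A"
  using add_A[OF one_A uminus_A[OF one_A]] by simp

lemma minus_A: "x \<in> A \<Longrightarrow> y \<in> A \<Longrightarrow> x - y \<in> A"
  using add_A[of x "- y"] uminus_A[of y] by simp

lemma sum_A: "(\<And>i. i \<in> I \<Longrightarrow> h i \<in> A) \<Longrightarrow> sum h I \<in> A"
  by (induction I rule: infinite_finite_induct) (auto simp: zero_A add_A)

lemma power_A: "x \<in> A \<Longrightarrow> x ^ k \<in> A"
  by (induction k) (auto simp: one_A mult_A)

definition polys :: "'r poly set" where
  "polys = {p. \<forall>i. coeff p i \<in> A}"

text \<open>The kernel of A[T] -> A[X]/(P \<inter> A[X]) with T going to X, that is, the relations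
  that \<open>X\<close> satisfies modulo \<open>P\<close>. It is a prime ideal of A[T].\<close>

definition ker :: "'r poly set" where
  "ker = {p \<in> polys. poly p X \<in> P}"

lemma coeff_polys: "p \<in> polys \<Longrightarrow> coeff p i \<in> A"
  by (simp add: polys_def)

lemma const_polys: "a \<in> A \<Longrightarrow> [:a:] \<in> polys"
  by (auto simp: polys_def coeff_pCons zero_A split: nat.split)

lemma zero_polys: "0 \<in> polys"
  by (simp add: polys_def zero_A)

lemma one_polys: "1 \<in> polys"
  using const_polys[OF one_A] by (simp add: one_pCons)

lemma monom_polys: "a \<in> A \<Longrightarrow> monom a k \<in> polys"
  by (simp add: polys_def zero_A)

lemma add_polys: "p \<in> polys \<Longrightarrow> q \<in> polys \<Longrightarrow> p + q \<in> polys"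
  by (simp add: polys_def add_A)

lemma minus_polys: "p \<in> polys \<Longrightarrow> q \<in> polys \<Longrightarrow> p - q \<in> polys"
  by (simp add: polys_def minus_A)

lemma mult_polys: "p \<in> polys \<Longrightarrow> q \<in> polys \<Longrightarrow> p * q \<in> polys"
  by (auto simp: polys_def coeff_mult intro!: sum_A mult_A)

lemma smult_polys: "a \<in> A \<Longrightarrow> p \<in> polys \<Longrightarrow> smult a p \<in> polys"
  by (simp add: polys_def mult_A)

lemmas polys_intros = const_polys zero_polys one_polys monom_polys add_polys minus_polys
  mult_polys smult_polys power_A coeff_polys

lemma ker_polys: "p \<in> ker \<Longrightarrow> p \<in> polys"
  by (simp add: ker_def)

lemma zero_ker: "0 \<in> ker"
  by (simp add: ker_def zero_P zero_polys)

lemma add_ker: "p \<in> ker \<Longrightarrow> q \<in> ker \<Longrightarrow> p + q \<in> ker"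
  by (simp add: ker_def add_P add_polys)

lemma mult_ker: "p \<in> polys \<Longrightarrow> q \<in> ker \<Longrightarrow> p * q \<in> ker"
  using mult_P[of p "poly q X"] by (simp add: ker_def mult_polys coeff_polys)

lemma minus_ker: "p \<in> ker \<Longrightarrow> q \<in> ker \<Longrightarrow> p - q \<in> ker"
  using add_ker[of p "[:-1:] * q"] mult_ker[of "[:-1:]" q] one_A
  by (simp add: polys_intros uminus_A)

lemma smult_ker: "a \<in> A \<Longrightarrow> p \<in> ker \<Longrightarrow> smult a p \<in> ker"
  using mult_ker[of "[:a:]" p] by (simp add: polys_intros)

lemma prime_ker: "p \<in> polys \<Longrightarrow> q \<in> polys \<Longrightarrow> p * q \<in> ker \<Longrightarrow> p \<in> ker \<or> q \<in> ker"
  using prime_P[of p q] by (simp add: ker_def coeff_polys)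

lemma const_ker_iff: "a \<in> A \<Longrightarrow> [:a:] \<in> ker \<longleftrightarrow> a \<in> P"
  by (simp add: ker_def polys_intros)

lemma prime_A: "a \<in> A \<Longrightarrow> b \<in> A \<Longrightarrow> a * b \<in> P \<Longrightarrow> a \<in> P \<or> b \<in> P"
  using prime_ker[of "[:a:]" "[:b:]"] by (simp add: const_ker_iff polys_intros mult_A mult.commute)

lemma mult_P_A: "a \<in> A \<Longrightarrow> x \<in> P \<Longrightarrow> a * x \<in> P"
  using mult_P[of "[:a:]" x] coeff_polys[OF const_polys] by simp

lemma sum_P: "(\<And>i. i \<in> I \<Longrightarrow> h i \<in> P) \<Longrightarrow> sum h I \<in> P"
  by (induction I rule: infinite_finite_induct) (auto simp: zero_P add_P)

lemma power_notin_P: "a \<in> A \<Longrightarrow> a \<notin> P \<Longrightarrow> a ^ k \<notin> P"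
  by (induction k) (use one_P prime_A power_A in auto)

lemma smult_ker_cancel: "a \<in> A \<Longrightarrow> a \<notin> P \<Longrightarrow> p \<in> polys \<Longrightarrow> smult a p \<in> ker \<Longrightarrow> p \<in> ker"
  using prime_ker[of "[:a:]" p] by (simp add: polys_intros const_ker_iff)

lemma monom_ker: "a \<in> A \<Longrightarrow> a \<in> P \<Longrightarrow> monom a k \<in> ker"
  using mult_P[of "monom 1 k" a] coeff_polys[OF monom_polys[OF one_A]]
  by (simp add: ker_def monom_polys poly_monom mult.commute)

text \<open>These are the trivial relations. \<open>X\<close> is transcendental modulo
  \<open>P\<close> exactly if there are no others.\<close>

lemma coeffs_in_P_imp_ker:
  assumes "p \<in> polys" "\<And>i. coeff p i \<in> P"
  shows "p \<in> ker"
proof -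
  have "(\<Sum>i\<in>I. monom (coeff p i) i) \<in> ker" for I
    by (induction I rule: infinite_finite_induct)
      (auto simp: zero_ker intro!: add_ker monom_ker assms coeff_polys)
  from this[of "{..degree p}"] show ?thesis
    by (simp add: poly_as_sum_of_monoms)
qed

section \<open>Pseudo-division and relations of minimal degree\<close>

text \<open>Long division without inverses: each step first multiplies \<open>f\<close> by the
  leading coefficient of \<open>g\<close>, and \<open>k\<close> counts the steps.\<close>

lemma pseudo_division:
  assumes "f \<in> polys" "g \<in> polys" "degree g > 0"
  obtains k q r where "q \<in> polys" "r \<in> polys" "smult (lead_coeff g ^ k) f = q * g + r"
    "degree r < degree g" "degree q \<le> degree f - degree g"
proof -
  have "\<exists>k. \<exists>q\<in>polys. \<exists>r\<in>polys. smult (lead_coeff g ^ k) f = q * g + r \<and>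
    degree r < degree g \<and> degree q \<le> degree f - degree g"
    using assms(1)
  proof (induction "degree f" arbitrary: f rule: less_induct)
    case less
    show ?case
    proof (cases "degree f < degree g")
      case True
      then show ?thesis using less.prems
        by (intro exI[of _ 0] bexI[of _ 0] bexI[of _ f]) (auto simp: zero_polys)
    next
      case False
      define c where "c = lead_coeff g"
      define h where "h = monom (lead_coeff f) (degree f - degree g)"
      define f' where "f' = smult c f - h * g"
      have c: "c \<in> A" and h: "h \<in> polys"
        unfolding c_def h_def using less.prems assms(2) by (simp_all add: polys_intros)
      have f': "f' \<in> polys"
        unfolding f'_def using less.prems assms(2) c h by (simp add: polys_intros)
      have "degree h \<le> degree f - degree g"
        by (simp add: h_def degree_monom_le)
      have "degree (h * g) \<le> degree f"
        using degree_mult_le[of h g] \<open>degree h \<le> _\<close> False by linarith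
      then have "degree f' \<le> degree f"
        unfolding f'_def by (intro degree_diff_le) (auto intro: degree_smult_le)
      moreover have "coeff f' (degree f) = 0"
        using False by (simp add: f'_def h_def c_def coeff_monom_mult)
      \<comment> \<open>For a constant \<open>f\<close>, a vanishing top coefficient would not lower
        the degree, since 0 has degree 0.\<close>
      moreover have "degree f > 0" using False assms(3) by simp
      ultimately have "degree f' < degree f"
        by (metis le_neq_implies_less leading_coeff_0_iff degree_0)
      from less.hyps[OF this f'] obtain k q r where
        q: "q \<in> polys" and r: "r \<in> polys" and eq: "smult (c ^ k) f' = q * g + r"
        and deg: "degree r < degree g" "degree q \<le> degree f' - degree g"
        unfolding c_def by blast
      have "smult (c ^ Suc k) f = smult (c ^ k) (f' + h * g)"
        by (simp add: f'_def mult.commute)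
      also have "\<dots> = (q + smult (c ^ k) h) * g + r"
        by (simp add: smult_add_right eq algebra_simps)
      finally have *: "smult (c ^ Suc k) f = (q + smult (c ^ k) h) * g + r" .
      have "degree (q + smult (c ^ k) h) \<le> degree f - degree g"
        using deg(2) \<open>degree f' < degree f\<close> \<open>degree h \<le> _\<close>
        by (intro degree_add_le) (auto intro: order.trans[OF degree_smult_le])
      moreover have "q + smult (c ^ k) h \<in> polys"
        using q h c by (simp add: polys_intros)
      ultimately show ?thesis
        using * r deg(1) unfolding c_def by blast
    qed
  qed
  with that show thesis by blast
qed

text \<open>Here \<open>g\<close> has least degree among the nontrivial relations. A constant
  relation lies in \<open>P\<close> and is trivial. If the leading coefficient were in
  \<open>P\<close>, dropping the leading monomial would give a shorter relation, trivial by
  minimality, so \<open>g\<close> would be trivial too.\<close>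

lemma minimal_relation:
  assumes "g \<in> ker" "coeff g j \<notin> P"
    and min: "\<And>r i. r \<in> ker \<Longrightarrow> degree r < degree g \<Longrightarrow> coeff r i \<in> P"
  shows "lead_coeff g \<notin> P" "degree g > 0"
proof -
  show "degree g > 0"
  proof (rule ccontr)
    assume "\<not> ?thesis"
    then obtain a where a: "g = [:a:]"
      by (auto elim: degree_eq_zeroE)
    then have "a \<in> P"
      using assms(1) by (simp add: ker_def)
    then show False
      using assms(2) a zero_P by (simp add: coeff_pCons split: nat.splits)
  qed
  show "lead_coeff g \<notin> P"
  proof
    assume *: "lead_coeff g \<in> P"
    let ?r = "g - monom (lead_coeff g) (degree g)"
    have "?r \<in> ker"
      using * assms(1) by (intro minus_ker monom_ker coeff_polys ker_polys)
    then have "coeff ?r j \<in> P"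
      using degree_drop_lead[of g] \<open>degree g > 0\<close> min[of ?r j] by simp
    moreover have "coeff g j = coeff ?r j + coeff (monom (lead_coeff g) (degree g)) j"
      by simp
    ultimately show False
      using assms(2) add_P * zero_P by (metis coeff_monom)
  qed
qed

text \<open>The remainder of a relation is again a relation, of degree below \<open>g\<close>, hence
  trivial. So \<open>g\<close> generates \<open>ker\<close> up to trivial relations and powers of
  its leading coefficient.\<close>

lemma divide_by_minimal_relation:
  assumes "g \<in> ker" "degree g > 0"
    and min: "\<And>r i. r \<in> ker \<Longrightarrow> degree r < degree g \<Longrightarrow> coeff r i \<in> P"
    and "h \<in> ker"
  obtains k q r where "smult (lead_coeff g ^ k) h = q * g + r" "r \<in> polys" "\<And>i. coeff r i \<in> P"
proof -
  obtain k q r where *: "q \<in> polys" "r \<in> polys" "smult (lead_coeff g ^ k) h = q * g + r"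
    "degree r < degree g"
    using pseudo_division[of h g] assms ker_polys by metis
  have "r = smult (lead_coeff g ^ k) h - q * g"
    using *(3) by simp
  also have "\<dots> \<in> ker"
    using assms *(1) by (intro minus_ker smult_ker mult_ker) (auto intro: polys_intros ker_polys)
  finally show thesis
    using that * min by blast
qed

text \<open>Modulo \<^term>\<open>P\<close> the element \<^term>\<open>X\<close> is algebraic over \<^term>\<open>A\<close>, so every
  nonzero element of the extension divides a nonzero element of \<^term>\<open>A\<close>.\<close>

lemma divides_base_element:
  assumes g: "g \<in> ker" "coeff g j \<notin> P"
    and min: "\<And>r i. r \<in> ker \<Longrightarrow> degree r < degree g \<Longrightarrow> coeff r i \<in> P"
    and f: "f \<in> polys" "f \<notin> ker"
  obtains u e where "u \<in> polys" "e \<in> A" "e \<notin> P" "u * f - [:e:] \<in> ker"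
proof -
  note lead_g = minimal_relation[OF g min]
  have g': "g \<in> polys" using g ker_polys by blast
  \<comment> \<open>\<open>J\<close> holds the nonzero multiples of \<open>f\<close> modulo
    \<open>ker\<close>. As in the Euclidean algorithm for \<open>f\<close> and \<open>g\<close>, an
    element of least degree turns out to be constant, and that constant is \<open>e\<close>.\<close>
  define J where "J = {h \<in> polys. h \<notin> ker \<and> (\<exists>u\<in>polys. u * f - h \<in> ker)}"
  have "f \<in> J"
    unfolding J_def using f zero_ker by (auto intro!: bexI[of _ 1] one_polys)
  then obtain h where "h \<in> J" and h_min: "\<And>h'. h' \<in> J \<Longrightarrow> degree h \<le> degree h'"
    using arg_min_nat_lemma[of "\<lambda>h. h \<in> J" f degree] by blast
  then obtain u where h: "h \<in> polys" "h \<notin> ker" and u: "u \<in> polys" "u * f - h \<in> ker"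
    by (auto simp: J_def)
  have J_I: "s \<in> J" if "s \<in> polys" "s \<notin> ker" "v \<in> polys" "v * h - s \<in> ker" for s v
  proof -
    have "(v * u) * f - s = v * (u * f - h) + (v * h - s)"
      by (simp add: algebra_simps)
    also have "\<dots> \<in> ker"
      using that u by (intro add_ker mult_ker)
    finally show ?thesis
      unfolding J_def using that u mult_polys by blast
  qed
  \<comment> \<open>The remainder of \<open>h\<close> on division by \<open>g\<close> is a nonzero
    multiple of \<open>h\<close> modulo \<open>ker\<close>, so it lies in \<open>J\<close> and its
    degree bounds that of \<open>h\<close>.\<close>
  have "degree h < degree g"
  proof -
    obtain k q r where *: "q \<in> polys" "r \<in> polys" "smult (lead_coeff g ^ k) h = q * g + r"
      "degree r < degree g"
      using pseudo_division[OF h(1) g' lead_g(2)] by metis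
    let ?c = "lead_coeff g ^ k"
    have c: "?c \<in> A" "?c \<notin> P"
      using g' lead_g(1) by (simp_all add: polys_intros power_notin_P)
    have "[:?c:] * h - r = q * g" using *(3) by simp
    also have "\<dots> \<in> ker" using * g by (intro mult_ker)
    finally have **: "[:?c:] * h - r \<in> ker" .
    have "r \<notin> ker"
      using add_ker[OF **, of r] smult_ker_cancel[OF c h(1)] h(2) by auto
    then have "r \<in> J"
      using J_I[OF *(2) _ const_polys[OF c(1)] **] by simp
    then show ?thesis using h_min *(4) by fastforce
  qed
  have "degree h = 0"
  proof (rule ccontr)
    assume "degree h \<noteq> 0"
    then have pos: "degree h > 0" by simp
    define c where "c = lead_coeff h"
    have c: "c \<in> A" using h by (simp add: c_def coeff_polys)
    \<comment> \<open>Otherwise the leading monomial of \<open>h\<close> is in \<open>ker\<close>,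
      and dropping it leaves an element of \<open>J\<close> of smaller degree.\<close>
    have "c \<notin> P"
    proof
      assume "c \<in> P"
      let ?m = "monom c (degree h)"
      have m: "?m \<in> ker" using \<open>c \<in> P\<close> c by (simp add: monom_ker)
      have "h - ?m \<notin> ker"
        using add_ker[OF _ m, of "h - ?m"] h(2) by auto
      then have "h - ?m \<in> J"
        using J_I[of "h - ?m" 1] h(1) m c by (simp add: polys_intros)
      then show False
        using h_min degree_drop_lead[OF pos] unfolding c_def by fastforce
    qed
    \<comment> \<open>Now \<open>g\<close> is divided by \<open>h\<close>. Since \<open>g\<close> is
      a relation, \<open>s\<close> is congruent to \<open>- q * h\<close> modulo \<open>ker\<close>;
      being shorter than \<open>h\<close>, it contradicts the choice of \<open>h\<close> once
      \<open>s \<notin> ker\<close> is known.\<close>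
    obtain k q s where *: "q \<in> polys" "s \<in> polys" "smult (c ^ k) g = q * h + s"
      "degree s < degree h" "degree q \<le> degree g - degree h"
      using pseudo_division[OF g' h(1) pos] unfolding c_def by metis
    have qhs: "q * h + s \<in> ker"
      unfolding *(3)[symmetric] using g c by (intro smult_ker power_A)
    \<comment> \<open>If \<open>s\<close> is a relation, so is \<open>q * h\<close>, hence
      \<open>q\<close> by primality. Both \<open>q\<close> and \<open>s\<close> are shorter than
      \<open>g\<close>, so their coefficients lie in \<open>P\<close>, and then so do those of
      \<open>c ^ k\<close> times \<open>g\<close>, against the choice of \<open>j\<close>.\<close>
    have "s \<notin> ker"
    proof
      assume s: "s \<in> ker"
      have "q * h \<in> ker" using minus_ker[OF qhs s] by simp
      then have "q \<in> ker" using prime_ker[OF *(1) h(1)] h(2) by blast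
      moreover have "degree q < degree g"
        using *(5) pos lead_g(2) by linarith
      ultimately have q: "coeff q i \<in> P" for i using min by blast
      have "coeff (q * h) i \<in> P" for i
        unfolding coeff_mult
      proof (rule sum_P)
        show "coeff q l * coeff h (i - l) \<in> P" for l
          using mult_P_A[OF coeff_polys[OF h(1), of "i - l"] q[of l]] by (simp add: mult.commute)
      qed
      moreover have "coeff s i \<in> P" for i
        using min[OF s] *(4) \<open>degree h < degree g\<close> by simp
      ultimately have "coeff (smult (c ^ k) g) j \<in> P"
        unfolding *(3) coeff_add by (intro add_P)
      then have "c ^ k \<in> P \<or> coeff g j \<in> P"
        using prime_A c g' by (simp add: polys_intros)
      then show False using g(2) power_notin_P[OF c \<open>c \<notin> P\<close>] by blast
    qed
    moreover have "(0 - q) * h - s \<in> ker"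
      using minus_ker[OF zero_ker qhs] by simp
    ultimately have "s \<in> J"
      using J_I[OF *(2), of "0 - q"] *(1) by (simp add: minus_polys zero_polys del: diff_0)
    then show False using h_min *(4) by fastforce
  qed
  then obtain e where e: "h = [:e:]" by (auto elim: degree_eq_zeroE)
  have "e \<in> A" using h(1) e coeff_polys[of h 0] by simp
  moreover from this have "e \<notin> P" using h(2) e const_ker_iff by simp
  ultimately show thesis using that u e by blast
qed

text \<open>The family \<open>\<psi>\<close> encodes a point of the base, namely the common restriction of all
  \<open>\<psi> t\<close> to \<^term>\<open>A\<close>, together with its extensions sending \<^term>\<open>X\<close> to \<open>t\<close>.
  If \<^term>\<open>P\<close> contains no relation for \<^term>\<open>X\<close>, any \<open>t\<close> avoiding the roots of \<open>f\<close>
  will do; otherwise \<open>t\<close> is a root of a relation \<open>g\<close> of minimal degree, and \<open>e\<close>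
  contains the leading coefficient of \<open>g\<close> as a factor.\<close>

lemma generic_lifting:
  assumes f: "f \<in> polys" "f \<notin> ker"
  obtains e where "e \<in> A" "e \<notin> P"
    "\<And>\<psi> :: 'k::alg_closed_field \<Rightarrow> 'r \<Rightarrow> 'k.
      (\<And>t. ring_morphism (\<psi> t)) \<Longrightarrow> (\<And>t. \<psi> t X = t) \<Longrightarrow>
      (\<And>t x. x \<in> A \<Longrightarrow> \<psi> t x = \<psi> 0 x) \<Longrightarrow> (\<And>x. x \<in> A \<Longrightarrow> x \<in> P \<Longrightarrow> \<psi> 0 x = 0) \<Longrightarrow>
      \<psi> 0 e \<noteq> 0 \<Longrightarrow> \<exists>t. \<psi> t (poly f X) \<noteq> 0 \<and> (\<forall>h\<in>ker. \<psi> t (poly h X) = 0)"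
proof (cases "\<forall>g\<in>ker. \<forall>i. coeff g i \<in> P")
  case True
  \<comment> \<open>This coefficient serves as \<open>e\<close>: where it does not vanish,
    \<open>f\<close> specialises to a nonzero polynomial in one variable.\<close>
  obtain i where i: "coeff f i \<notin> P"
    using f coeffs_in_P_imp_ker by blast
  show thesis
  proof (rule that[of "coeff f i"])
    fix \<psi> :: "'k \<Rightarrow> 'r \<Rightarrow> 'k"
    assume hom: "\<And>t. ring_morphism (\<psi> t)" and X: "\<And>t. \<psi> t X = t"
      and indep: "\<And>t x. x \<in> A \<Longrightarrow> \<psi> t x = \<psi> 0 x"
      and vanish: "\<And>x. x \<in> A \<Longrightarrow> x \<in> P \<Longrightarrow> \<psi> 0 x = 0" and e: "\<psi> 0 (coeff f i) \<noteq> 0"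
    note zero = ring_morphism_zero[OF hom]
    have ev: "\<psi> t (poly h X) = poly (map_poly (\<psi> 0) h) t" if "h \<in> polys" for h t
      using ring_morphism_poly[OF hom zero indep[OF coeff_polys[OF that]], where x = X] unfolding X .
    have "map_poly (\<psi> 0) f \<noteq> 0"
      using e zero by (metis coeff_map_poly coeff_0)
    then obtain t where "poly (map_poly (\<psi> 0) f) t \<noteq> 0"
      by (rule alg_closed_exists_nonroot)
    moreover have "\<psi> t (poly h X) = 0" if "h \<in> ker" for h
    proof -
      have "map_poly (\<psi> 0) h = 0"
        using True that vanish coeff_polys[OF ker_polys[OF that]] zero
        by (intro poly_eqI) (simp add: coeff_map_poly)
      then show ?thesis using ev[OF ker_polys[OF that]] by simp
    qed
    ultimately show "\<exists>t. \<psi> t (poly f X) \<noteq> 0 \<and> (\<forall>h\<in>ker. \<psi> t (poly h X) = 0)"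
      using ev[OF f(1)] by auto
  qed (use i f in \<open>auto intro: coeff_polys\<close>)
next
  case False
  \<comment> \<open>The nontrivial relations; \<open>g\<close> is one of least degree.\<close>
  define W where "W = {g \<in> ker. \<exists>i. coeff g i \<notin> P}"
  from False obtain g0 where "g0 \<in> W" by (auto simp: W_def)
  then obtain g where "g \<in> W" and W_min: "\<And>g'. g' \<in> W \<Longrightarrow> degree g \<le> degree g'"
    using arg_min_nat_lemma[of "\<lambda>g. g \<in> W" g0 degree] by blast
  then obtain j where g: "g \<in> ker" "coeff g j \<notin> P" by (auto simp: W_def)
  have min: "coeff r i \<in> P" if "r \<in> ker" "degree r < degree g" for r i
    using W_min[of r] that by (force simp: W_def)
  note lead_g = minimal_relation[OF g min]
  have g': "g \<in> polys" using g ker_polys by blast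
  define c where "c = lead_coeff g"
  have c: "c \<in> A" "c \<notin> P" using g' lead_g by (simp_all add: c_def coeff_polys)
  obtain u e where u: "u \<in> polys" and e: "e \<in> A" "e \<notin> P" and ue: "u * f - [:e:] \<in> ker"
    using divides_base_element[OF g min f] by metis
  show thesis
  \<comment> \<open>Nonvanishing of \<open>c\<close> keeps the specialised \<open>g\<close>
    nonconstant, so that it has a root \<open>t\<close>; nonvanishing of \<open>e\<close> forces
    \<open>f\<close> to be nonzero there, because \<open>u * f\<close> takes the value of
    \<open>e\<close>.\<close>
  proof (rule that[of "c * e"])
    fix \<psi> :: "'k \<Rightarrow> 'r \<Rightarrow> 'k"
    assume hom: "\<And>t. ring_morphism (\<psi> t)" and X: "\<And>t. \<psi> t X = t"
      and indep: "\<And>t x. x \<in> A \<Longrightarrow> \<psi> t x = \<psi> 0 x"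
      and vanish: "\<And>x. x \<in> A \<Longrightarrow> x \<in> P \<Longrightarrow> \<psi> 0 x = 0" and ce: "\<psi> 0 (c * e) \<noteq> 0"
    note zero = ring_morphism_zero[OF hom]
    note hom_simps = ring_morphism_add[OF hom] ring_morphism_mult[OF hom]
      ring_morphism_minus[OF hom] ring_morphism_power[OF hom]
    have ev: "\<psi> t (poly h X) = poly (map_poly (\<psi> 0) h) t" if "h \<in> polys" for h t
      using ring_morphism_poly[OF hom zero indep[OF coeff_polys[OF that]], where x = X] unfolding X .
    have c0: "\<psi> 0 c \<noteq> 0" and e0: "\<psi> 0 e \<noteq> 0"
      using ce by (auto simp: hom_simps)
    have "coeff (map_poly (\<psi> 0) g) (degree g) \<noteq> 0"
      using c0 zero by (simp add: coeff_map_poly c_def)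
    then have "degree (map_poly (\<psi> 0) g) > 0"
      using le_degree lead_g(2) by fastforce
    then obtain t where "poly (map_poly (\<psi> 0) g) t = 0"
      using alg_closed_imp_poly_has_root by blast
    then have gt: "\<psi> t (poly g X) = 0" using ev[OF g'] by simp
    have ker_t: "\<psi> t (poly h X) = 0" if h: "h \<in> ker" for h
    proof -
      \<comment> \<open>At the chosen point \<open>g\<close> vanishes by the choice of
        \<open>t\<close>, and \<open>r\<close> because its coefficients do; the power of
        \<open>c\<close> can then be cancelled.\<close>
      obtain k q r where *: "smult (c ^ k) h = q * g + r" "r \<in> polys" "\<And>i. coeff r i \<in> P"
        using divide_by_minimal_relation[OF g(1) lead_g(2) min h] unfolding c_def by metis
      have "map_poly (\<psi> 0) r = 0"
        using *(3) vanish coeff_polys[OF *(2)] zero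
        by (intro poly_eqI) (simp add: coeff_map_poly)
      then have "\<psi> t (poly r X) = 0" using ev[OF *(2)] by simp
      moreover have "\<psi> t (poly (smult (c ^ k) h) X) = \<psi> t (poly (q * g + r) X)"
        by (simp add: *(1))
      ultimately have "\<psi> t c ^ k * \<psi> t (poly h X) = 0"
        by (simp add: hom_simps gt)
      then show ?thesis using c0 indep[OF c(1), of t] by simp
    qed
    have "\<psi> t (poly u X) * \<psi> t (poly f X) = \<psi> t e"
      using ker_t[OF ue] by (simp add: hom_simps)
    then have "\<psi> t (poly f X) \<noteq> 0"
      using e0 indep[OF e(1), of t] by auto
    with ker_t show "\<exists>t. \<psi> t (poly f X) \<noteq> 0 \<and> (\<forall>h\<in>ker. \<psi> t (poly h X) = 0)"
      by blast
  qed (use c e prime_A in \<open>auto intro: mult_A\<close>)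
qed

end

section \<open>Evaluation of multivariate polynomials\<close>

lemma mpoly_eval_cong:
  assumes "\<And>i. i \<in> mpoly_vars p \<Longrightarrow> a i = b i"
  shows "mpoly_eval p a = mpoly_eval p b"
proof -
  have "a i = b i" if "m \<in> Poly_Mapping.keys p" "i \<in> Poly_Mapping.keys m" for m i
    using assms that by (auto simp: mpoly_vars_def)
  then show ?thesis
    by (simp add: mpoly_eval_def)
qed

lemma mpoly_eval_superset:
  assumes "finite S" "Poly_Mapping.keys p \<subseteq> S"
  shows "mpoly_eval p a = (\<Sum>m\<in>S. Poly_Mapping.lookup p m *
           (\<Prod>i\<in>Poly_Mapping.keys m. a i ^ Poly_Mapping.lookup m i))"
  unfolding mpoly_eval_def
  using assms by (intro sum.mono_neutral_left) (auto simp: in_keys_iff)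

lemma mpoly_eval_add: "mpoly_eval (p + q) a = mpoly_eval p a + mpoly_eval q a"
proof -
  let ?S = "Poly_Mapping.keys p \<union> Poly_Mapping.keys q"
  have "Poly_Mapping.keys (p + q) \<subseteq> ?S" by (rule Poly_Mapping.keys_add)
  then show ?thesis
    by (simp add: mpoly_eval_superset[of ?S] lookup_add algebra_simps sum.distrib)
qed

lemma mpoly_eval_zero: "mpoly_eval 0 a = 0"
  by (simp add: mpoly_eval_def)

lemma mpoly_eval_sum: "mpoly_eval (sum h I) a = (\<Sum>i\<in>I. mpoly_eval (h i) a)"
  by (induction I rule: infinite_finite_induct) (auto simp: mpoly_eval_zero mpoly_eval_add)

lemma mpoly_eval_single:
  "mpoly_eval (Poly_Mapping.single m c) a =
     c * (\<Prod>i\<in>Poly_Mapping.keys m. a i ^ Poly_Mapping.lookup m i)"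
  by (subst mpoly_eval_superset[of "{m}"]) auto

text \<open>All three products may be taken over the union of the supports, since the additional
  factors have exponent 0.\<close>

lemma prod_keys_add:
  fixes m m' :: "nat \<Rightarrow>\<^sub>0 nat" and a :: "nat \<Rightarrow> 'a::comm_semiring_1"
  shows "(\<Prod>i\<in>Poly_Mapping.keys (m + m'). a i ^ Poly_Mapping.lookup (m + m') i) =
    (\<Prod>i\<in>Poly_Mapping.keys m. a i ^ Poly_Mapping.lookup m i) *
    (\<Prod>i\<in>Poly_Mapping.keys m'. a i ^ Poly_Mapping.lookup m' i)"
proof -
  let ?S = "Poly_Mapping.keys m \<union> Poly_Mapping.keys m'"
  have *: "(\<Prod>i\<in>Poly_Mapping.keys l. a i ^ Poly_Mapping.lookup l i) =
      (\<Prod>i\<in>?S. a i ^ Poly_Mapping.lookup l i)" if "Poly_Mapping.keys l \<subseteq> ?S" for l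
    using that by (intro prod.mono_neutral_left) (auto simp: in_keys_iff)
  show ?thesis
    unfolding *[OF Poly_Mapping.keys_add] *[OF Un_upper1] *[OF Un_upper2]
    by (simp add: lookup_add power_add prod.distrib)
qed

lemma sum_single_lookup:
  "(\<Sum>m\<in>Poly_Mapping.keys p. Poly_Mapping.single m (Poly_Mapping.lookup p m)) = p"
  by (rule poly_mapping_eqI)
    (simp add: lookup_sum lookup_single when_def in_keys_iff)

text \<open>Both factors are expanded into monomials, which reduces the claim to
  \<open>prod_keys_add\<close>.\<close>

lemma mpoly_eval_mult:
  fixes p q :: "'a::comm_semiring_1 mpoly"
  shows "mpoly_eval (p * q) a = mpoly_eval p a * mpoly_eval q a"
proof -
  let ?s = "\<lambda>p m. Poly_Mapping.single m (Poly_Mapping.lookup p m) :: 'a mpoly"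
  have "p * q = (\<Sum>m\<in>Poly_Mapping.keys p. \<Sum>l\<in>Poly_Mapping.keys q. ?s p m * ?s q l)"
    by (simp add: sum_single_lookup flip: sum_product)
  then have "mpoly_eval (p * q) a = (\<Sum>m\<in>Poly_Mapping.keys p. \<Sum>l\<in>Poly_Mapping.keys q.
      mpoly_eval (?s p m) a * mpoly_eval (?s q l) a)"
    by (simp add: mpoly_eval_sum mpoly_eval_single mult_single prod_keys_add mult_ac)
  also have "\<dots> = mpoly_eval p a * mpoly_eval q a"
    unfolding sum_product[symmetric] by (simp only: mpoly_eval_single mpoly_eval_def[of p] mpoly_eval_def[of q])
  finally show ?thesis .
qed

lemma mpoly_eval_one: "mpoly_eval 1 a = 1"
  using mpoly_eval_single[of 0 1 a] by simp

lemma ring_morphism_mpoly_eval: "ring_morphism (\<lambda>p. mpoly_eval p a)"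
  by (simp add: ring_morphism_def mpoly_eval_one mpoly_eval_add mpoly_eval_mult)

section \<open>Splitting off the last variable\<close>

definition mpoly_var :: "nat \<Rightarrow> 'a::comm_semiring_1 mpoly" where
  "mpoly_var k = Poly_Mapping.single (Poly_Mapping.single k 1) 1"

lemma mpoly_eval_var: "mpoly_eval (mpoly_var k) a = a k"
  by (simp add: mpoly_var_def mpoly_eval_single)

lemma mpoly_vars_var: "mpoly_vars (mpoly_var k) \<subseteq> {k}"
  by (auto simp: mpoly_var_def mpoly_vars_def split: if_splits)

lemma mpoly_var_power:
  "mpoly_var k ^ e = Poly_Mapping.single (Poly_Mapping.single k e) 1"
  by (induction e) (simp_all add: mpoly_var_def mult_single flip: Poly_Mapping.single_add)

lemma mpoly_vars_one: "mpoly_vars 1 = {}"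
  by (simp add: mpoly_vars_def)

lemma mpoly_vars_zero: "mpoly_vars 0 = {}"
  by (simp add: mpoly_vars_def)

lemma mpoly_vars_poly_var:
  fixes q :: "'a::comm_ring_1 mpoly poly"
  assumes "\<And>i. mpoly_vars (coeff q i) \<subseteq> {..<k}"
  shows "mpoly_vars (poly q (mpoly_var k)) \<subseteq> {..<Suc k}"
  using assms
proof (induction q)
  case 0
  then show ?case by (simp add: mpoly_vars_zero)
next
  case (pCons c q)
  have "mpoly_vars (coeff q i) \<subseteq> {..<k}" for i
    using pCons.prems[of "Suc i"] by simp
  then have "mpoly_vars (poly q (mpoly_var k)) \<subseteq> {..<Suc k}"
    by (rule pCons.IH)
  moreover have "mpoly_vars c \<subseteq> {..<k}"
    using pCons.prems[of 0] by simp
  ultimately show ?case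
    using mpoly_vars_add[of c "mpoly_var k * poly q (mpoly_var k)"]
      mpoly_vars_mult[of "mpoly_var k" "poly q (mpoly_var k)"]
      mpoly_vars_var[of k, where ?'a = 'a]
    by (force simp: subset_iff)
qed

text \<open>The polynomials of this form are closed under sums, and each monomial is one of them:
  its power of variable \<open>k\<close> is split off.\<close>

lemma mpoly_as_poly_in_last_var:
  fixes p :: "'a::comm_ring_1 mpoly"
  assumes "mpoly_vars p \<subseteq> {..<Suc k}"
  obtains q where "\<And>i. mpoly_vars (coeff q i) \<subseteq> {..<k}" "poly q (mpoly_var k) = p"
proof -
  let ?good = "\<lambda>p. \<exists>q. (\<forall>i. mpoly_vars (coeff q i) \<subseteq> {..<k}) \<and> poly q (mpoly_var k) = p"
  have add: "?good (x + y)" if "?good x" "?good y" for x y :: "'a mpoly"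
  proof -
    from that obtain q r where
      "\<And>i. mpoly_vars (coeff q i) \<subseteq> {..<k}" "poly q (mpoly_var k) = x"
      "\<And>i. mpoly_vars (coeff r i) \<subseteq> {..<k}" "poly r (mpoly_var k) = y" by auto
    then show ?thesis
      using mpoly_vars_add by (intro exI[of _ "q + r"]) (simp, blast)
  qed
  have single: "?good (Poly_Mapping.single m c)" if m: "Poly_Mapping.keys m \<subseteq> {..<Suc k}"
    for m and c :: 'a
  proof -
    \<comment> \<open>The exponent vector \<open>m\<close> with the exponent of variable
      \<open>k\<close> erased.\<close>
    define m' where "m' = Poly_Mapping.update k 0 m"
    have "m = m' + Poly_Mapping.single k (Poly_Mapping.lookup m k)"
      by (rule poly_mapping_eqI)
        (simp add: m'_def lookup_add lookup_update lookup_single when_def)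
    then have eq: "poly (monom (Poly_Mapping.single m' c) (Poly_Mapping.lookup m k)) (mpoly_var k)
        = Poly_Mapping.single m c"
      by (simp add: poly_monom mpoly_var_power mult_single)
    have "Poly_Mapping.keys m' \<subseteq> {..<k}"
    proof
      fix i assume "i \<in> Poly_Mapping.keys m'"
      then have "i \<noteq> k" "i \<in> Poly_Mapping.keys m"
        by (auto simp: m'_def in_keys_iff lookup_update split: if_splits)
      then show "i \<in> {..<k}" using m by (auto simp: less_Suc_eq)
    qed
    then have "mpoly_vars (Poly_Mapping.single m' c) \<subseteq> {..<k}"
      by (auto simp: mpoly_vars_def split: if_splits)
    then have "mpoly_vars (coeff (monom (Poly_Mapping.single m' c) (Poly_Mapping.lookup m k)) i) \<subseteq> {..<k}"
      for i by (simp add: mpoly_vars_zero)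
    with eq show ?thesis by blast
  qed
  have "?good (\<Sum>m\<in>S. Poly_Mapping.single m (Poly_Mapping.lookup p m))"
    if "S \<subseteq> Poly_Mapping.keys p" for S
    using finite_subset[OF that finite_keys] that
  proof (induction S rule: finite_induct)
    case empty
    show ?case by (auto intro!: exI[of _ 0] simp: mpoly_vars_zero)
  next
    case (insert m S)
    have "Poly_Mapping.keys m \<subseteq> {..<Suc k}"
      using insert.prems assms by (auto simp: mpoly_vars_def)
    then show ?case
      using insert single[of m] add by simp
  qed
  from this[of "Poly_Mapping.keys p"] show thesis
    using that by (auto simp: sum_single_lookup)
qed

lemma mpoly_no_vars:
  assumes "mpoly_vars p \<subseteq> {}"
  shows "p = Poly_Mapping.single 0 (Poly_Mapping.lookup p 0)"
proof -
  have "Poly_Mapping.keys p \<subseteq> {0}"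
    using assms by (auto simp: mpoly_vars_def)
  then show ?thesis
    by (intro poly_mapping_eqI) (auto simp: lookup_single when_def in_keys_iff)
qed

section \<open>Generic points by induction on the number of variables\<close>

text \<open>\<open>P\<close> is prime only inside the carrier; as \<open>k < n\<close>, polynomials
  in the first \<open>k + 1\<close> variables belong to it.\<close>

lemma prime_in_simple_extension_mpoly:
  assumes "primeideal P (mpoly_ring n :: 'a::comm_ring_1 mpoly ring)" "k < n"
  shows "prime_in_simple_extension {p. mpoly_vars p \<subseteq> {..<k}} P (mpoly_var k)"
proof -
  interpret primeideal P "mpoly_ring n" by fact
  have carrier: "poly q (mpoly_var k) \<in> carrier (mpoly_ring n)"
    if "\<And>i. coeff q i \<in> {p. mpoly_vars p \<subseteq> {..<k}}" for q :: "'a mpoly poly"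
    using mpoly_vars_poly_var[of q k] that assms(2) by (force simp: mpoly_ring_def)
  show ?thesis
  proof
    show "1 \<notin> P"
      using I_notcarr one_imp_carrier by (auto simp: mpoly_ring_def)
    show "0 \<in> P"
      using additive_subgroup.zero_closed[OF is_additive_subgroup] by (simp add: mpoly_ring_def)
    show "x + y \<in> P" if "x \<in> P" "y \<in> P" for x y
      using additive_subgroup.a_closed[OF is_additive_subgroup that] by (simp add: mpoly_ring_def)
    show "poly p (mpoly_var k) * x \<in> P"
      if "\<And>i. coeff p i \<in> {p. mpoly_vars p \<subseteq> {..<k}}" "x \<in> P" for p x
      using I_l_closed[OF that(2) carrier[OF that(1)]] by (simp add: mpoly_ring_def)
    show "poly p (mpoly_var k) \<in> P \<or> poly q (mpoly_var k) \<in> P"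
      if "\<And>i. coeff p i \<in> {p. mpoly_vars p \<subseteq> {..<k}}"
        "\<And>i. coeff q i \<in> {p. mpoly_vars p \<subseteq> {..<k}}"
        "poly p (mpoly_var k) * poly q (mpoly_var k) \<in> P" for p q
      using I_prime[OF carrier[OF that(1)] carrier[OF that(2)]] that(3)
      by (simp add: mpoly_ring_def)
  qed (use mpoly_vars_add mpoly_vars_mult in
      \<open>fastforce simp: mpoly_vars_one mpoly_vars_uminus\<close>)+
qed

text \<open>An arbitrary \<open>f\<close> is carried along because the step needs the induction
  hypothesis for the element \<open>e\<close> from \<open>generic_lifting\<close>. A point is a
  function on all of \<open>nat\<close>, of which only the coordinates below \<open>k\<close>
  matter.\<close>

lemma generic_point:
  fixes P :: "'k::alg_closed_field mpoly set"
  assumes "primeideal P (mpoly_ring n)" "k \<le> n"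
    and "mpoly_vars f \<subseteq> {..<k}" "f \<notin> P"
  shows "\<exists>a. mpoly_eval f a \<noteq> 0 \<and>
    (\<forall>h\<in>P. mpoly_vars h \<subseteq> {..<k} \<longrightarrow> mpoly_eval h a = 0)"
  using assms(2-)
proof (induction k arbitrary: f)
  case 0
  interpret primeideal P "mpoly_ring n" by fact
  have zero: "0 \<in> P"
    using additive_subgroup.zero_closed[OF is_additive_subgroup] by (simp add: mpoly_ring_def)
  obtain c where c: "f = Poly_Mapping.single 0 c"
    using mpoly_no_vars[of f] 0 by auto
  then have "c \<noteq> 0" using 0(3) zero by auto
  then have f: "mpoly_eval f a \<noteq> 0" for a
    by (simp add: c mpoly_eval_single)
  \<comment> \<open>A nonzero constant is a unit, and the proper ideal \<open>P\<close> contains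
    none.\<close>
  have zero_only: "h = 0" if h: "h \<in> P" "mpoly_vars h \<subseteq> {..<0}" for h
  proof (rule ccontr)
    assume "h \<noteq> 0"
    obtain d where d: "h = Poly_Mapping.single 0 d"
      using mpoly_no_vars[of h] h(2) by auto
    have "d \<noteq> 0" using \<open>h \<noteq> 0\<close> d by auto
    have "Poly_Mapping.single 0 (inverse d) \<in> carrier (mpoly_ring n)"
      by (simp add: mpoly_ring_def mpoly_vars_def)
    from I_l_closed[OF \<open>h \<in> P\<close> this] have "1 \<in> P"
      using \<open>d \<noteq> 0\<close> d by (simp add: mpoly_ring_def mult_single)
    then show False
      using I_notcarr one_imp_carrier by (auto simp: mpoly_ring_def)
  qed
  show ?case
  proof (intro exI conjI ballI impI)
    show "mpoly_eval f (\<lambda>_. 0) \<noteq> 0" by (rule f)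
    show "mpoly_eval h (\<lambda>_. 0) = 0" if "h \<in> P" "mpoly_vars h \<subseteq> {..<0}" for h
      unfolding zero_only[OF that] by (rule mpoly_eval_zero)
  qed
next
  case (Suc k)
  let ?A = "{p :: 'k mpoly. mpoly_vars p \<subseteq> {..<k}}"
  interpret E: prime_in_simple_extension ?A P "mpoly_var k"
    by (rule prime_in_simple_extension_mpoly[OF assms(1)]) (use Suc.prems(1) in simp)
  have as_poly: "\<exists>q\<in>E.polys. poly q (mpoly_var k) = h"
    if h: "mpoly_vars h \<subseteq> {..<Suc k}" for h :: "'k mpoly"
  proof -
    obtain q where "\<And>i. mpoly_vars (coeff q i) \<subseteq> {..<k}" "poly q (mpoly_var k) = h"
      using mpoly_as_poly_in_last_var[OF h] by blast
    then show ?thesis by (intro bexI[of _ q]) (simp_all add: E.polys_def)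
  qed
  obtain q where q: "q \<in> E.polys" "poly q (mpoly_var k) = f"
    using as_poly[OF Suc.prems(2)] by blast
  then have "q \<notin> E.ker" using Suc.prems(3) by (simp add: E.ker_def)
  from q(1) this show ?case
  proof (rule E.generic_lifting[where ?'k = 'k])
    fix e
    assume e: "e \<in> ?A" "e \<notin> P" and
      lift: "\<And>\<psi> :: 'k \<Rightarrow> 'k mpoly \<Rightarrow> 'k.
        (\<And>t. ring_morphism (\<psi> t)) \<Longrightarrow> (\<And>t. \<psi> t (mpoly_var k) = t) \<Longrightarrow>
        (\<And>t x. x \<in> ?A \<Longrightarrow> \<psi> t x = \<psi> 0 x) \<Longrightarrow> (\<And>x. x \<in> ?A \<Longrightarrow> x \<in> P \<Longrightarrow> \<psi> 0 x = 0) \<Longrightarrow>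
        \<psi> 0 e \<noteq> 0 \<Longrightarrow> \<exists>t. \<psi> t (poly q (mpoly_var k)) \<noteq> 0 \<and>
          (\<forall>h\<in>E.ker. \<psi> t (poly h (mpoly_var k)) = 0)"
    \<comment> \<open>The induction hypothesis for \<open>e\<close> in place of \<open>f\<close>
      provides the base point that is to be extended.\<close>
    obtain a where a: "mpoly_eval e a \<noteq> 0"
      "\<And>h. h \<in> P \<Longrightarrow> mpoly_vars h \<subseteq> {..<k} \<Longrightarrow> mpoly_eval h a = 0"
      using Suc.IH[of e] Suc.prems(1) e by auto
    have upd: "mpoly_eval h (a(k := t)) = mpoly_eval h a" if "h \<in> ?A" for h t
      using that by (intro mpoly_eval_cong) auto
    have "\<exists>t. mpoly_eval (poly q (mpoly_var k)) (a(k := t)) \<noteq> 0 \<and>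
        (\<forall>h\<in>E.ker. mpoly_eval (poly h (mpoly_var k)) (a(k := t)) = 0)"
    \<comment> \<open>Evaluation at \<open>a(k := t)\<close> sends the new variable to
      \<open>t\<close>, and by \<open>upd\<close> its restriction to \<open>?A\<close> does not
      depend on \<open>t\<close>.\<close>
    proof (rule lift[of "\<lambda>t p. mpoly_eval p (a(k := t))"], goal_cases)
      case 1 show ?case by (rule ring_morphism_mpoly_eval)
    next
      case 2 show ?case by (simp add: mpoly_eval_var)
    next
      case (3 t x) then show ?case by (simp only: upd)
    next
      case (4 x) then show ?case by (subst upd) (use a(2) in auto)
    next
      case 5 show ?case using a(1) e(1) by (subst upd)
    qed
    then obtain t where t: "mpoly_eval f (a(k := t)) \<noteq> 0"
      "\<And>h. h \<in> E.ker \<Longrightarrow> mpoly_eval (poly h (mpoly_var k)) (a(k := t)) = 0"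
      using q(2) by blast
    \<comment> \<open>By \<open>as_poly\<close>, such an \<open>h\<close> is the value at
      \<open>mpoly_var k\<close> of a member of \<open>E.ker\<close>.\<close>
    have "mpoly_eval h (a(k := t)) = 0" if "h \<in> P" "mpoly_vars h \<subseteq> {..<Suc k}" for h
      using as_poly[OF that(2)] t(2) that(1) unfolding E.ker_def by blast
    with t(1) show "\<exists>a. mpoly_eval f a \<noteq> 0 \<and>
      (\<forall>h\<in>P. mpoly_vars h \<subseteq> {..<Suc k} \<longrightarrow> mpoly_eval h a = 0)"
      by blast
  qed
qed

section \<open>Existence of prime ideals, and the zero of the given ideal\<close>

text \<open>Zorn's lemma for the ideals above \<open>I\<close> that avoid \<open>\<one>\<close>, a
  condition preserved by unions of chains; a maximal such ideal is a maximal ideal, hence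
  prime.\<close>

lemma (in cring) exists_primeideal_containing:
  assumes "ideal I R" "I \<noteq> carrier R"
  obtains P where "primeideal P R" "I \<subseteq> P"
proof -
  let ?S = "{J. ideal J R \<and> \<one> \<notin> J \<and> I \<subseteq> J}"
  have "\<exists>M\<in>?S. \<forall>J\<in>?S. M \<subseteq> J \<longrightarrow> J = M"
  proof (rule subset_Zorn_nonempty)
    show "?S \<noteq> {}"
      using assms ideal.one_imp_carrier by blast
  next
    fix C assume C: "C \<noteq> {}" "subset.chain ?S C"
    then have "subset.chain {J. ideal J R} C"
      by (auto simp: pred_on.chain_def)
    then have "ideal (\<Union>C) R"
      using chain_Union_is_ideal[of C] C(1) by simp
    then show "\<Union>C \<in> ?S"
      using C by (auto simp: pred_on.chain_def)
  qed
  then obtain M where M: "ideal M R" "\<one> \<notin> M" "I \<subseteq> M"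
    and max: "\<And>J. ideal J R \<Longrightarrow> \<one> \<notin> J \<Longrightarrow> M \<subseteq> J \<Longrightarrow> J = M"
    by auto
  have "maximalideal M R"
  proof (rule maximalidealI[OF M(1)])
    show "carrier R \<noteq> M" using M(2) by auto
    show "J = M \<or> J = carrier R" if "ideal J R" "M \<subseteq> J" "J \<subseteq> carrier R" for J
      using max[OF that(1) _ that(2)] ideal.one_imp_carrier[OF that(1)] by blast
  qed
  then show thesis
    using that M(3) maximalideal_prime by blast
qed

theorem mainTheorem1:
  fixes n :: nat and \<aa> :: "'k::alg_closed_field mpoly set"
  assumes "ideal \<aa> (mpoly_ring n)"
    and "\<aa> \<noteq> carrier (mpoly_ring n)"
  shows "zero_locus n \<aa> \<noteq> {}"
proof -
  interpret cring "mpoly_ring n :: 'k mpoly ring" by (rule cring_mpoly_ring)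
  obtain P where P: "primeideal P (mpoly_ring n)" "\<aa> \<subseteq> P"
    using exists_primeideal_containing[OF assms] by blast
  interpret P: primeideal P "mpoly_ring n" by fact
  have "1 \<notin> P"
    using P.I_notcarr P.one_imp_carrier by (auto simp: mpoly_ring_def)
  then obtain a where a: "\<And>h. h \<in> P \<Longrightarrow> mpoly_vars h \<subseteq> {..<n} \<Longrightarrow> mpoly_eval h a = 0"
    using generic_point[OF P(1), of n 1] by (auto simp: mpoly_vars_one)
  \<comment> \<open>Points of \<open>affine_space n\<close> are undefined outside
    \<open>{..<n}\<close>, so \<open>a\<close> is restricted; elements of the ideal involve only
    variables below \<open>n\<close> and keep their values.\<close>
  have "mpoly_eval f (restrict a {..<n}) = 0" if "f \<in> \<aa>" for f
  proof -
    have "f \<in> P" using that P(2) by blast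
    moreover from this have "mpoly_vars f \<subseteq> {..<n}"
      using P.Icarr by (auto simp: mpoly_ring_def)
    moreover have "mpoly_eval f (restrict a {..<n}) = mpoly_eval f a"
      using \<open>mpoly_vars f \<subseteq> {..<n}\<close> by (intro mpoly_eval_cong) auto
    ultimately show ?thesis using a by simp
  qed
  then have "restrict a {..<n} \<in> zero_locus n \<aa>"
    by (simp add: zero_locus_def affine_space_def)
  then show ?thesis by blast
qed

end
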